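(* Let $F$ be a field of characteristic zero, let $E$ be an $n$-dimensional evolution algebra over $F$ with structural matrix $A=(a_{i,j})$, and suppose that $\dim M(E)=n$ and $\operatorname{rank}A=1$. Then the associative enveloping algebra $M(E)$ is isomorphic to one of the algebras $M^s$, $1\le s\le n$, where $M^s$ is the $n$-dimensional $F$-algebra with basis $x_1,\dots,x_n$ and multiplication $$x_ix_j=x_i,\qquad 1\le i\le n,\ 1\le j\le s,$$ all other products of basis elements being zero.
   Context: An $n$-dimensional evolution algebra $E$ over $F$ is an algebra with a basis $\{e_1,\dots,e_n\}$ (the evolution basis) such that $e_i\cdot e_j=0$ for $i\ne j$ and $e_i\cdot e_i=\sum_{k=1}^n a_{i,k}e_k$; $A=(a_{i,k})$ is its matrix of structural constants. For $x\in E$, $R_x:E\to E$ is the right multiplication $R_x(y)=yx$. The associative enveloping algebra $M(E)$ is the (not necessarily unital) associative algebra of linear operators generated by $\{R_x: x\in E\}$, equivalently by $R_{e_1},\dots,R_{e_n}$. Operators are identified with matrices by $R_{e_i}=\sum_{k=1}^n a_{i,k}e_{i,k}$, where $e_{i,k}$ are matrix units, and multiplied as matrices, so that $R_{e_i}R_{e_j}=a_{i,j}\sum_{k=1}^n a_{j,k}e_{i,k}$. *)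

theory Defs
  imports Jordan_Normal_Form.DL_Rank "HOL-Library.Function_Algebras"
begin

text \<open>
  Indices run over \<open>{..<n}\<close> instead of \<open>{1..n}\<close>, in accordance with matrices and
  vectors of Jordan_Normal_Form.
\<close>

subsection \<open>Evolution algebras\<close>

locale evolution_algebra = vector_space scale
  for scale :: "'f::field \<Rightarrow> 'e::ab_group_add \<Rightarrow> 'e" (infixr \<open>*s\<close> 75) +
  fixes emult :: "'e \<Rightarrow> 'e \<Rightarrow> 'e" (infixl \<open>\<star>\<close> 70)
    and n :: nat
    and e :: "nat \<Rightarrow> 'e"
    and A :: "'f mat"
  assumes linear_mult_left: "Vector_Spaces.linear scale scale (\<lambda>y. y \<star> x)"
    and linear_mult_right: "Vector_Spaces.linear scale scale (\<lambda>y. x \<star> y)"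
    and inj_basis: "inj_on e {..<n}"
    and independent_basis: "independent (e ` {..<n})"
    and span_basis: "span (e ` {..<n}) = UNIV"
    and structure_matrix: "A \<in> carrier_mat n n"
    and mult_basis_distinct: "\<lbrakk>i < n; j < n; i \<noteq> j\<rbrakk> \<Longrightarrow> e i \<star> e j = 0"
    and mult_basis_same: "i < n \<Longrightarrow> e i \<star> e i = (\<Sum>k<n. A $$ (i, k) *s e k)"

subsection \<open>Possibly non-unital algebras over a field\<close>

record ('f, 'a) algebra_struct = "'a partial_object" +
  alg_add :: "'a \<Rightarrow> 'a \<Rightarrow> 'a"
  alg_smult :: "'f \<Rightarrow> 'a \<Rightarrow> 'a"
  alg_mult :: "'a \<Rightarrow> 'a \<Rightarrow> 'a"

definition algebra_isomorphic ::
    "('f, 'a) algebra_struct \<Rightarrow> ('f, 'b) algebra_struct \<Rightarrow> bool" where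
  "algebra_isomorphic S T \<longleftrightarrow>
    (\<exists>\<phi>. bij_betw \<phi> (carrier S) (carrier T) \<and>
      (\<forall>x\<in>carrier S. \<forall>y\<in>carrier S. \<phi> (alg_add S x y) = alg_add T (\<phi> x) (\<phi> y)) \<and>
      (\<forall>c. \<forall>x\<in>carrier S. \<phi> (alg_smult S c x) = alg_smult T c (\<phi> x)) \<and>
      (\<forall>x\<in>carrier S. \<forall>y\<in>carrier S. \<phi> (alg_mult S x y) = alg_mult T (\<phi> x) (\<phi> y)))"

subsection \<open>The associative enveloping algebra\<close>

definition op_scale :: "('f \<Rightarrow> 'e \<Rightarrow> 'e) \<Rightarrow> 'f \<Rightarrow> ('e \<Rightarrow> 'e) \<Rightarrow> ('e \<Rightarrow> 'e)" where
  "op_scale scale c f = (\<lambda>x. scale c (f x))"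

text \<open>
  Operators act on row vectors: the matrix of \<open>R\<close> has the coordinates of \<open>R (e i)\<close>
  as its \<open>i\<close>-th row.  Hence the matrix product of (the matrices of) \<open>f\<close> and \<open>g\<close>
  corresponds to applying \<open>f\<close> first and \<open>g\<close> second; composing in the other order would
  give the opposite algebra.
\<close>

definition op_mult :: "('e \<Rightarrow> 'e) \<Rightarrow> ('e \<Rightarrow> 'e) \<Rightarrow> ('e \<Rightarrow> 'e)" where
  "op_mult f g = g \<circ> f"

definition right_mult :: "('e \<Rightarrow> 'e \<Rightarrow> 'e) \<Rightarrow> 'e \<Rightarrow> ('e \<Rightarrow> 'e)" where
  "right_mult emult x = (\<lambda>y. emult y x)"

definition op_subalgebra ::
    "('f::field \<Rightarrow> 'e::ab_group_add \<Rightarrow> 'e) \<Rightarrow> ('e \<Rightarrow> 'e) set \<Rightarrow> bool" where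
  "op_subalgebra scale B \<longleftrightarrow>
    Modules.module.subspace (op_scale scale) B \<and> (\<forall>f\<in>B. \<forall>g\<in>B. op_mult f g \<in> B)"

definition enveloping_set ::
    "('f::field \<Rightarrow> 'e::ab_group_add \<Rightarrow> 'e) \<Rightarrow> ('e \<Rightarrow> 'e \<Rightarrow> 'e) \<Rightarrow> ('e \<Rightarrow> 'e) set" where
  "enveloping_set scale emult = op_subalgebra scale hull range (right_mult emult)"

definition enveloping_algebra ::
    "('f::field \<Rightarrow> 'e::ab_group_add \<Rightarrow> 'e) \<Rightarrow> ('e \<Rightarrow> 'e \<Rightarrow> 'e) \<Rightarrow> ('f, 'e \<Rightarrow> 'e) algebra_struct"
  where
  "enveloping_algebra scale emult =
    \<lparr>carrier = enveloping_set scale emult, alg_add = (+), alg_smult = op_scale scale,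
     alg_mult = op_mult\<rparr>"

lemma vector_space_op_scale:
  assumes "vector_space scale"
  shows "vector_space (op_scale scale)"
proof -
  interpret vector_space scale by fact
  show ?thesis
    by unfold_locales
      (auto simp: op_scale_def fun_eq_iff scale_right_distrib scale_left_distrib)
qed

lemma (in evolution_algebra) op_mult_right_mult_basis:
  assumes "i < n" "j < n" "l < n"
  shows "op_mult (right_mult emult (e i)) (right_mult emult (e j)) (e l) =
    (if l = i then A $$ (i, j) *s (\<Sum>k<n. A $$ (j, k) *s e k) else 0)"
proof -
  interpret R: Vector_Spaces.linear scale scale "\<lambda>y. y \<star> e j"
    by (rule linear_mult_left)
  have "(\<Sum>k<n. A $$ (i, k) *s e k) \<star> e j = (\<Sum>k<n. A $$ (i, k) *s (e k \<star> e j))"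
    by (simp add: R.sum R.scale)
  also have "\<dots> = (\<Sum>k<n. if k = j then A $$ (i, j) *s (e j \<star> e j) else 0)"
    by (rule sum.cong) (auto simp: mult_basis_distinct assms)
  finally show ?thesis
    using assms R.zero
    by (auto simp: op_mult_def right_mult_def mult_basis_distinct mult_basis_same)
qed

subsection \<open>The algebras \<open>M\<^sup>s\<close>\<close>

text \<open>
  The basis vector \<open>x\<^sub>i\<close> is \<open>unit_vec n i\<close>; the product is the bilinear extension of
  \<open>x\<^sub>i x\<^sub>j = x\<^sub>i\<close> for \<open>j < s\<close> and \<open>x\<^sub>i x\<^sub>j = 0\<close> otherwise.
\<close>

definition M_mult :: "nat \<Rightarrow> nat \<Rightarrow> 'f::field vec \<Rightarrow> 'f vec \<Rightarrow> 'f vec" where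
  "M_mult n s x y =
    vec n (\<lambda>k. \<Sum>i<n. \<Sum>j<n. x $ i * y $ j * (if j < s then unit_vec n i else 0\<^sub>v n) $ k)"

definition M_algebra :: "nat \<Rightarrow> nat \<Rightarrow> ('f::field, 'f vec) algebra_struct" where
  "M_algebra n s =
    \<lparr>carrier = carrier_vec n, alg_add = (+), alg_smult = (\<cdot>\<^sub>v), alg_mult = M_mult n s\<rparr>"

lemma M_mult_unit_vec:
  assumes "i < n" "j < n"
  shows "M_mult n s (unit_vec n i) (unit_vec n j) =
    (if j < s then unit_vec n i else (0\<^sub>v n :: 'f::field vec))" (is "_ = ?r")
proof (rule eq_vecI)
  fix k assume "k < dim_vec ?r"
  then have k: "k < n" by (simp split: if_splits)
  have "M_mult n s (unit_vec n i) (unit_vec n j) $ k =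
    (\<Sum>a<n. \<Sum>b<n. if b = j then (if a = i then ?r $ k else 0) else 0)"
    unfolding M_mult_def index_vec[OF k]
    by (intro sum.cong refl) (auto simp: assms k)
  also have "\<dots> = ?r $ k"
    using assms by simp
  finally show "M_mult n s (unit_vec n i) (unit_vec n j) $ k = ?r $ k" .
qed (simp add: M_mult_def)

end

theory Submission
  imports Defs
begin

text \<open>
  If \<open>A\<close> has rank one, its \<open>2 \<times> 2\<close> minors vanish, and \<open>a\<^sub>i\<^sub>j a\<^sub>j\<^sub>k = a\<^sub>j\<^sub>j a\<^sub>i\<^sub>k\<close> turns
  the product of two generators \<open>R\<^sub>i = R\<^bsub>e i\<^esub>\<close> of \<open>M(E)\<close> into a multiple of the first one:
  \<open>R\<^sub>i R\<^sub>j = a\<^sub>j\<^sub>j R\<^sub>i\<close> (\<open>op_mult_right_mult_diagonal\<close>).  The span of the \<open>R\<^sub>i\<close> is therefore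
  already closed under multiplication and equals \<open>M(E)\<close>; since the dimension is \<open>n\<close>, the \<open>R\<^sub>i\<close>
  form a basis.  By bilinearity, \<open>f g = \<lambda>(g) f\<close> on \<open>M(E)\<close>, where \<open>\<lambda>\<close> is the linear functional
  with \<open>\<lambda>(R\<^sub>j) = a\<^sub>j\<^sub>j\<close>.

  The functional \<open>\<lambda>\<close> is not zero.  Choose \<open>a\<^sub>i\<^sub>j \<noteq> 0\<close>; as \<open>R\<^sub>j \<noteq> 0\<close>, some entry \<open>a\<^sub>j\<^sub>k\<close> of row
  \<open>j\<close> is nonzero as well, and \<open>a\<^sub>j\<^sub>j a\<^sub>i\<^sub>k = a\<^sub>i\<^sub>j a\<^sub>j\<^sub>k \<noteq> 0\<close> gives \<open>a\<^sub>j\<^sub>j \<noteq> 0\<close>.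

  An algebra whose product is \<open>f g = \<lambda>(g) f\<close> is determined up to isomorphism by its dimension
  and by whether \<open>\<lambda>\<close> vanishes, because a linear automorphism carries any nonzero functional to
  any other one.  In \<open>M\<^sup>s\<close> the functional is the sum of the first \<open>s\<close> coordinates.  Hence every
  \<open>s\<close> between \<open>1\<close> and \<open>n\<close> would do; the proof takes \<open>s = n\<close>, for which
  \<open>algebra_isomorphic_M_algebra\<close> constructs the isomorphism with no permutation of the basis.
\<close>

section \<open>Minors of a matrix of rank at most one\<close>

text \<open>
  Two columns with a nonvanishing \<open>2 \<times> 2\<close> minor are distinct and linearly independent, by
  Cramer's rule, and would force the rank to be at least two.
\<close>

lemma (in vec_space) minor_eq_if_rank_le_1:
  assumes A: "A \<in> carrier_mat n nc" and rank: "rank A \<le> 1"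
    and "i < n" "k < n" "j < nc" "l < nc"
  shows "A $$ (i, j) * A $$ (k, l) = A $$ (i, l) * A $$ (k, j)"
proof (rule ccontr)
  assume neq: "A $$ (i, j) * A $$ (k, l) \<noteq> A $$ (i, l) * A $$ (k, j)"
  define v w where "v = col A j" and "w = col A l"
  have entries: "v $ i = A $$ (i, j)" "v $ k = A $$ (k, j)" "w $ i = A $$ (i, l)" "w $ k = A $$ (k, l)"
    using A \<open>i < n\<close> \<open>k < n\<close> \<open>j < nc\<close> \<open>l < nc\<close> by (simp_all add: v_def w_def)
  have carrier: "{v, w} \<subseteq> carrier_vec n" using A by (auto simp: v_def w_def)
  have "v \<noteq> w" using neq entries by (metis mult.commute)
  have "lin_indpt {v, w}"
  proof (rule finite_lin_indpt2)
    fix a assume zero: "lincomb a {v, w} = 0\<^sub>v n"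
    have row: "a v * v $ r + a w * w $ r = 0" if "r < n" for r
    proof -
      have "lincomb a {v, w} $ r = a v * v $ r + a w * w $ r"
        using lincomb_index[OF that carrier] \<open>v \<noteq> w\<close> by simp
      then show ?thesis using zero that by simp
    qed
    have "a v * (v $ i * w $ k - w $ i * v $ k) =
        (a v * v $ i + a w * w $ i) * w $ k - (a v * v $ k + a w * w $ k) * w $ i"
      "a w * (v $ i * w $ k - w $ i * v $ k) =
        (a v * v $ k + a w * w $ k) * v $ i - (a v * v $ i + a w * w $ i) * v $ k"
      by (simp_all add: algebra_simps)
    then have "a v * (v $ i * w $ k - w $ i * v $ k) = 0" "a w * (v $ i * w $ k - w $ i * v $ k) = 0"
      unfolding row[OF \<open>i < n\<close>] row[OF \<open>k < n\<close>] by simp_all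
    then show "\<forall>u\<in>{v, w}. a u = 0"
      using neq entries by auto
  qed (use carrier in auto)
  moreover have "{v, w} \<subseteq> set (cols A)"
    using A \<open>j < nc\<close> \<open>l < nc\<close> by (auto simp: v_def w_def cols_def)
  ultimately have "card {v, w} \<le> rank A"
    using rank_ge_card_indpt[OF A] by blast
  then show False using rank \<open>v \<noteq> w\<close> by simp
qed

section \<open>Algebras with product \<open>f g = \<lambda>(g) f\<close>\<close>

lemma M_mult_n_eq_smult:
  assumes "x \<in> carrier_vec n"
  shows "M_mult n n x y = (\<Sum>j<n. y $ j) \<cdot>\<^sub>v x"
proof (rule eq_vecI)
  fix k assume "k < dim_vec ((\<Sum>j<n. y $ j) \<cdot>\<^sub>v x)"
  then have k: "k < n" using assms by simp
  have "M_mult n n x y $ k = (\<Sum>i<n. if i = k then (\<Sum>j<n. x $ k * y $ j) else 0)"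
    unfolding M_mult_def index_vec[OF k] by (intro sum.cong refl) (auto simp: k)
  then show "M_mult n n x y $ k = ((\<Sum>j<n. y $ j) \<cdot>\<^sub>v x) $ k"
    using k assms by (simp add: sum_distrib_left mult.commute)
qed (use assms in \<open>simp add: M_mult_def\<close>)

text \<open>
  Here \<open>\<lambda>\<close> takes the value \<open>\<mu> j\<close> on the basis vector \<open>x j\<close>.  An isomorphism onto \<open>M\<^sup>n\<close> is a linear
  bijection that transports \<open>\<lambda>\<close> to the coordinate sum.  It suffices to alter the
  \<open>p\<close>-th coordinate: adding \<open>\<Sum>\<^sub>j (\<mu> j - 1) c\<^sub>j\<close> to it makes the coordinate sum equal to
  \<open>\<Sum>\<^sub>j \<mu> j c\<^sub>j\<close>, and the change is invertible because the new \<open>p\<close>-th coordinate contains \<open>c\<^sub>p\<close>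
  with the coefficient \<open>\<mu> p \<noteq> 0\<close>.
\<close>

lemma (in vector_space) algebra_isomorphic_M_algebra:
  fixes mult :: "'b \<Rightarrow> 'b \<Rightarrow> 'b" and x :: "nat \<Rightarrow> 'b" and \<mu> :: "nat \<Rightarrow> 'a"
  assumes inj: "inj_on x {..<n}" and indep: "independent (x ` {..<n})"
    and mult: "\<And>a b. mult (\<Sum>i<n. a i *s x i) (\<Sum>j<n. b j *s x j) =
      (\<Sum>j<n. b j * \<mu> j) *s (\<Sum>i<n. a i *s x i)"
    and p: "p < n" "\<mu> p \<noteq> 0"
  shows "algebra_isomorphic
    \<lparr>carrier = span (x ` {..<n}), alg_add = (+), alg_smult = scale, alg_mult = mult\<rparr>
    (M_algebra n n)"
proof -
  let ?S = "span (x ` {..<n})"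
  define c where "c f i = representation (x ` {..<n}) f (x i)" for f i
  define w where "w f i = c f i + (if i = p then \<Sum>j<n. (\<mu> j - 1) * c f j else 0)" for f i
  define \<phi> where "\<phi> f = vec n (w f)" for f
  \<comment> \<open>The correction \<open>\<sigma> = \<Sum>\<^sub>j (\<mu> j - 1) c\<^sub>j\<close> is recovered from the altered coordinates \<open>y\<close>:
    \<open>\<Sum>\<^sub>j (1 - \<mu> j) y\<^sub>j = -\<sigma> + (1 - \<mu> p) \<sigma> = -\<mu> p \<sigma>\<close>, which explains the inverse \<open>\<theta>\<close>.\<close>
  define \<theta> where "\<theta> y i = y $ i + (if i = p then (\<Sum>j<n. (1 - \<mu> j) * y $ j) / \<mu> p else 0)"
    for y :: "'a vec" and i
  define \<psi> where "\<psi> y = (\<Sum>i<n. \<theta> y i *s x i)" for y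

  have expand: "(\<Sum>i<n. c f i *s x i) = f" if "f \<in> ?S" for f
    using sum_representation_eq[OF indep that, of "x ` {..<n}"] inj
    by (simp add: c_def sum.reindex)
  have add: "c (f + g) i = c f i + c g i" if "f \<in> ?S" "g \<in> ?S" for f g i
    using representation_add[OF indep that(2,1)] by (simp add: c_def add.commute)
  have scale: "c (a *s f) i = a * c f i" if "f \<in> ?S" for a f i
    using representation_scale[OF indep that] by (simp add: c_def)
  have in_span: "(\<Sum>i<n. a i *s x i) \<in> ?S" for a
    by (intro span_sum span_scale span_base) auto
  have coord: "c (\<Sum>i<n. a i *s x i) k = a k" if "k < n" for a k
  proof -
    have "c (\<Sum>i<n. a i *s x i) k = (\<Sum>i<n. a i * (if x k = x i then 1 else 0))"
      unfolding c_def using indep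
      by (subst representation_sum)
        (simp_all add: span_scale span_base representation_scale representation_basis)
    also have "\<dots> = (\<Sum>i<n. if i = k then a i else 0)"
      using inj that by (intro sum.cong) (auto dest: inj_onD)
    finally show ?thesis using that by simp
  qed
  have sum_at_p: "(\<Sum>i<n. b i * (y i + (if i = p then s else 0))) = (\<Sum>i<n. b i * y i) + b p * s"
    for b y :: "nat \<Rightarrow> 'a" and s
  proof -
    have "(\<Sum>i<n. b i * (y i + (if i = p then s else 0))) =
        (\<Sum>i<n. b i * y i + (if i = p then b p * s else 0))"
      by (intro sum.cong) (auto simp: algebra_simps)
    then show ?thesis using p by (simp add: sum.distrib)
  qed
  have sum_w: "(\<Sum>i<n. w f i) = (\<Sum>j<n. c f j * \<mu> j)" for f
    using sum_at_p[of "\<lambda>_. 1" "c f" "\<Sum>j<n. (\<mu> j - 1) * c f j"]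
    by (simp add: w_def algebra_simps flip: sum.distrib)
  have mult': "mult f g = (\<Sum>j<n. c g j * \<mu> j) *s f" if "f \<in> ?S" "g \<in> ?S" for f g
    using mult[of "c f" "c g"] expand that by simp
  have \<phi>_scale: "\<phi> (a *s f) = a \<cdot>\<^sub>v \<phi> f" if "f \<in> ?S" for a f
    using that by (auto simp: \<phi>_def w_def scale sum_distrib_left algebra_simps)
  have \<phi>_mult: "\<phi> (mult f g) = M_mult n n (\<phi> f) (\<phi> g)" if "f \<in> ?S" "g \<in> ?S" for f g
  proof -
    have "(\<Sum>j<n. \<phi> g $ j) = (\<Sum>j<n. c g j * \<mu> j)"
      using sum_w[of g] by (simp add: \<phi>_def)
    then show ?thesis
      using that by (simp add: mult' \<phi>_scale M_mult_n_eq_smult \<phi>_def[of f])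
  qed
  have \<psi>_\<phi>: "\<psi> (\<phi> f) = f" if "f \<in> ?S" for f
  proof -
    have "(\<Sum>j<n. (1 - \<mu> j) * w f j) =
        (\<Sum>j<n. (1 - \<mu> j) * c f j) + (1 - \<mu> p) * (\<Sum>j<n. (\<mu> j - 1) * c f j)"
      unfolding w_def by (rule sum_at_p)
    also have "(\<Sum>j<n. (1 - \<mu> j) * c f j) = - (\<Sum>j<n. (\<mu> j - 1) * c f j)"
      by (simp add: algebra_simps flip: sum_negf)
    finally have "\<theta> (\<phi> f) i = c f i" if "i < n" for i
      using p that by (simp add: \<theta>_def \<phi>_def w_def field_simps)
    then show ?thesis using expand[OF that] by (simp add: \<psi>_def)
  qed
  have \<phi>_\<psi>: "\<phi> (\<psi> y) = y" if "y \<in> carrier_vec n" for y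
  proof -
    have c: "c (\<psi> y) i = \<theta> y i" if "i < n" for i
      unfolding \<psi>_def using that by (rule coord)
    have "(\<Sum>j<n. (\<mu> j - 1) * \<theta> y j) =
        (\<Sum>j<n. (\<mu> j - 1) * y $ j) + (\<mu> p - 1) * ((\<Sum>j<n. (1 - \<mu> j) * y $ j) / \<mu> p)"
      unfolding \<theta>_def by (rule sum_at_p)
    also have "(\<Sum>j<n. (\<mu> j - 1) * y $ j) = - (\<Sum>j<n. (1 - \<mu> j) * y $ j)"
      by (simp add: algebra_simps flip: sum_negf)
    finally have "w (\<psi> y) i = y $ i" if "i < n" for i
      using p that by (simp add: w_def c) (simp add: \<theta>_def field_simps)
    then show ?thesis using that by (auto simp: \<phi>_def)
  qed
  have "bij_betw \<phi> ?S (carrier_vec n)"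
    by (rule bij_betw_byWitness[where f' = \<psi>])
      (use \<psi>_\<phi> \<phi>_\<psi> in_span in \<open>auto simp: \<phi>_def \<psi>_def\<close>)
  moreover have "\<phi> (f + g) = \<phi> f + \<phi> g" if "f \<in> ?S" "g \<in> ?S" for f g
    using that by (intro eq_vecI) (simp_all add: \<phi>_def w_def add distrib_left sum.distrib add_ac)
  ultimately show ?thesis
    using \<phi>_scale \<phi>_mult by (auto simp: algebra_isomorphic_def M_algebra_def)
qed

section \<open>Products of right multiplications\<close>

lemma op_scale_apply: "op_scale scale c f y = scale c (f y)"
  by (simp add: op_scale_def)

lemma op_sum_apply: "(\<Sum>i\<in>I. op_scale scale (a i) (f i)) y = (\<Sum>i\<in>I. scale (a i) (f i y))"
  by (induction I rule: infinite_finite_induct) (auto simp: op_scale_def)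

context evolution_algebra
begin

lemma basis_expansion: obtains a where "x = (\<Sum>i<n. a i *s e i)"
proof -
  have "x \<in> span (e ` {..<n})" by (simp add: span_basis)
  then obtain u where "x = (\<Sum>v\<in>e ` {..<n}. u v *s v)"
    by (auto simp: span_finite)
  then show thesis using that[of "u \<circ> e"] inj_basis by (simp add: sum.reindex)
qed

lemma right_mult_expansion:
  "right_mult emult (\<Sum>i<n. a i *s e i) = (\<Sum>i<n. op_scale scale (a i) (right_mult emult (e i)))"
proof
  fix y
  interpret L: Vector_Spaces.linear scale scale "\<lambda>x. y \<star> x" by (rule linear_mult_right)
  show "right_mult emult (\<Sum>i<n. a i *s e i) y =
      (\<Sum>i<n. op_scale scale (a i) (right_mult emult (e i))) y"
    by (simp add: op_sum_apply right_mult_def L.sum L.scale)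
qed

lemma right_mult_basis_eq_0:
  assumes j: "j < n" and row: "\<And>k. k < n \<Longrightarrow> A $$ (j, k) = 0"
  shows "right_mult emult (e j) = 0"
proof
  fix y
  interpret J: Vector_Spaces.linear scale scale "\<lambda>y. y \<star> e j" by (rule linear_mult_left)
  have "e l \<star> e j = 0" if "l < n" for l
    using that j row by (cases "l = j") (simp_all add: mult_basis_distinct mult_basis_same)
  moreover obtain a where "y = (\<Sum>l<n. a l *s e l)" by (rule basis_expansion)
  ultimately show "right_mult emult (e j) y = 0 y"
    by (simp add: right_mult_def J.sum J.scale)
qed

text \<open>
  \<open>R\<^sub>i R\<^sub>j\<close> sends \<open>e i\<close> to \<open>a\<^sub>i\<^sub>j\<close> times row \<open>j\<close> and kills the rest of the basis, so it is governed by
  the products \<open>a\<^sub>i\<^sub>j a\<^sub>j\<^sub>k\<close>; the minors rewrite these as \<open>a\<^sub>j\<^sub>j a\<^sub>i\<^sub>k\<close>, a multiple of row \<open>i\<close>.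
\<close>

lemma op_mult_right_mult_diagonal:
  assumes minors: "\<And>i j k l. \<lbrakk>i < n; j < n; k < n; l < n\<rbrakk> \<Longrightarrow>
      A $$ (i, j) * A $$ (k, l) = A $$ (i, l) * A $$ (k, j)"
    and i: "i < n" and j: "j < n"
  shows "op_mult (right_mult emult (e i)) (right_mult emult (e j)) =
    op_scale scale (A $$ (j, j)) (right_mult emult (e i))"
proof
  fix y
  interpret I: Vector_Spaces.linear scale scale "\<lambda>y. y \<star> e i" by (rule linear_mult_left)
  interpret J: Vector_Spaces.linear scale scale "\<lambda>y. y \<star> e j" by (rule linear_mult_left)
  have basis: "(e l \<star> e i) \<star> e j = A $$ (j, j) *s (e l \<star> e i)" if l: "l < n" for l
  proof -
    have "A $$ (i, j) *s (\<Sum>k<n. A $$ (j, k) *s e k) = A $$ (j, j) *s (\<Sum>k<n. A $$ (i, k) *s e k)"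
      using minors[OF i j j] by (simp add: scale_sum_right mult.commute)
    then show ?thesis
      using op_mult_right_mult_basis[OF i j l] i l
      by (auto simp: op_mult_def right_mult_def mult_basis_distinct mult_basis_same)
  qed
  obtain a where "y = (\<Sum>l<n. a l *s e l)" by (rule basis_expansion)
  then show "op_mult (right_mult emult (e i)) (right_mult emult (e j)) y =
      op_scale scale (A $$ (j, j)) (right_mult emult (e i)) y"
    by (simp add: op_mult_def right_mult_def op_scale_def I.sum I.scale J.sum J.scale basis
        scale_sum_right mult.commute)
qed

lemma op_mult_combination:
  assumes prod: "\<And>i j. \<lbrakk>i < n; j < n\<rbrakk> \<Longrightarrow>
      op_mult (right_mult emult (e i)) (right_mult emult (e j)) =
      op_scale scale (\<mu> j) (right_mult emult (e i))"
  shows "op_mult (\<Sum>i<n. op_scale scale (a i) (right_mult emult (e i)))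
      (\<Sum>j<n. op_scale scale (b j) (right_mult emult (e j))) =
    op_scale scale (\<Sum>j<n. b j * \<mu> j) (\<Sum>i<n. op_scale scale (a i) (right_mult emult (e i)))"
proof
  fix y
  have R: "(y \<star> e i) \<star> e j = \<mu> j *s (y \<star> e i)" if "i < n" "j < n" for i j
    using fun_cong[OF prod[OF that], of y] by (simp add: op_mult_def right_mult_def op_scale_def)
  have "(\<Sum>i<n. a i *s (y \<star> e i)) \<star> e j = \<mu> j *s (\<Sum>i<n. a i *s (y \<star> e i))" if "j < n" for j
  proof -
    interpret J: Vector_Spaces.linear scale scale "\<lambda>y. y \<star> e j" by (rule linear_mult_left)
    show ?thesis using that by (simp add: J.sum J.scale R scale_sum_right mult.commute)
  qed
  then show "op_mult (\<Sum>i<n. op_scale scale (a i) (right_mult emult (e i)))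
      (\<Sum>j<n. op_scale scale (b j) (right_mult emult (e j))) y =
    op_scale scale (\<Sum>j<n. b j * \<mu> j) (\<Sum>i<n. op_scale scale (a i) (right_mult emult (e i))) y"
    by (simp add: op_mult_def op_sum_apply op_scale_apply right_mult_def scale_sum_left)
qed

section \<open>The enveloping algebra and its basis\<close>

text \<open>
  Any operator \<open>R\<^sub>x\<close> is a combination of the \<open>R\<^sub>i\<close>, and the multiplication rule keeps products of
  such combinations in the span, so that no longer words in the generators are needed.
\<close>

lemma enveloping_set_eq_span:
  assumes prod: "\<And>i j. \<lbrakk>i < n; j < n\<rbrakk> \<Longrightarrow>
      op_mult (right_mult emult (e i)) (right_mult emult (e j)) =
      op_scale scale (\<mu> j) (right_mult emult (e i))"
  shows "enveloping_set scale emult =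
    Modules.module.span (op_scale scale) ((\<lambda>i. right_mult emult (e i)) ` {..<n})"
proof -
  interpret op: vector_space "op_scale scale"
    by (rule vector_space_op_scale) (rule vector_space_axioms)
  let ?R = "\<lambda>i. right_mult emult (e i)"
  have combination: "(\<Sum>i<n. op_scale scale (a i) (?R i)) \<in> op.span (?R ` {..<n})" for a
    by (intro op.span_sum op.span_scale op.span_base) auto
  have expansion: "\<exists>a. f = (\<Sum>i<n. op_scale scale (a i) (?R i))" if "f \<in> op.span (?R ` {..<n})" for f
    using that
  proof (induction rule: op.span_induct_alt)
    case base
    show ?case by (rule exI[of _ "\<lambda>_. 0"]) (simp only: op.scale_zero_left sum.neutral_const)
  next
    case (step c f g)
    then obtain i a where i: "i < n" "f = ?R i" and a: "g = (\<Sum>i<n. op_scale scale (a i) (?R i))"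
      by auto
    have "(\<Sum>k<n. op_scale scale (a k + (if k = i then c else 0)) (?R k)) =
      (\<Sum>k<n. op_scale scale (a k) (?R k)) + (\<Sum>k<n. if k = i then op_scale scale c (?R k) else 0)"
      unfolding sum.distrib[symmetric] op.scale_left_distrib by (intro sum.cong) auto
    then show ?case using i a
      by (intro exI[of _ "\<lambda>k. a k + (if k = i then c else 0)"]) (simp add: add.commute)
  qed
  show ?thesis
    unfolding enveloping_set_def
  proof (rule hull_unique)
    show "range (right_mult emult) \<subseteq> op.span (?R ` {..<n})"
    proof (rule image_subsetI)
      fix x
      obtain a where "x = (\<Sum>i<n. a i *s e i)" by (rule basis_expansion)
      then show "right_mult emult x \<in> op.span (?R ` {..<n})"
        using combination[of a] by (simp only: right_mult_expansion)
    qed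
    have "op_mult f g \<in> op.span (?R ` {..<n})"
      if f: "f \<in> op.span (?R ` {..<n})" and g: "g \<in> op.span (?R ` {..<n})" for f g
    proof -
      obtain a b where ab: "f = (\<Sum>i<n. op_scale scale (a i) (?R i))"
          "g = (\<Sum>j<n. op_scale scale (b j) (?R j))"
        using expansion[OF f] expansion[OF g] by blast
      have "op_mult f g = op_scale scale (\<Sum>j<n. b j * \<mu> j) f"
        unfolding ab using prod by (rule op_mult_combination)
      then show ?thesis using op.span_scale[OF f] by simp
    qed
    then show "op_subalgebra scale (op.span (?R ` {..<n}))"
      by (simp add: op_subalgebra_def)
    show "op.span (?R ` {..<n}) \<subseteq> T" if "range (right_mult emult) \<subseteq> T" "op_subalgebra scale T" for T
      using that by (intro op.span_minimal) (auto simp: op_subalgebra_def)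
  qed
qed

end

text \<open>
  The injectivity is a separate conclusion because the image of an indexed family forgets
  repetitions: the family is a basis only if its members are also pairwise distinct.
\<close>

lemma (in vector_space) inj_independent_if_dim_span_eq:
  assumes "dim (span (x ` {..<n})) = n"
  shows "inj_on x {..<n}" "independent (x ` {..<n})"
proof -
  have "n \<le> card (x ` {..<n})"
    using assms dim_le_card'[of "x ` {..<n}"] by simp
  then have card: "card (x ` {..<n}) = n"
    using card_image_le[of "{..<n}" x] by simp
  then show "inj_on x {..<n}" by (intro eq_card_imp_inj_on) simp_all
  show "independent (x ` {..<n})"
  proof -
    obtain B where B: "B \<subseteq> x ` {..<n}" "independent B" "x ` {..<n} \<subseteq> span B" "card B = dim (x ` {..<n})"
      using basis_exists by blast
    then have "B = x ` {..<n}" using card assms by (intro card_subset_eq) simp_all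
    then show ?thesis using B by simp
  qed
qed

section \<open>Enveloping algebras of rank-one evolution algebras\<close>

theorem proposition4p2:
  fixes scale :: "'f::field_char_0 \<Rightarrow> 'e::ab_group_add \<Rightarrow> 'e"
    and emult :: "'e \<Rightarrow> 'e \<Rightarrow> 'e"
    and n :: nat
    and e :: "nat \<Rightarrow> 'e"
    and A :: "'f mat"
  assumes "evolution_algebra scale emult n e A"
    and "vector_space.dim (op_scale scale) (enveloping_set scale emult) = n"
    and "vec_space.rank n A = 1"
  shows "\<exists>s\<in>{1..n}. algebra_isomorphic (enveloping_algebra scale emult) (M_algebra n s)"
proof -
  interpret evolution_algebra scale emult n e A by fact
  interpret op: vector_space "op_scale scale"
    by (rule vector_space_op_scale) (rule vector_space_axioms)
  let ?R = "\<lambda>i. right_mult emult (e i)"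
  have minors: "A $$ (i, j) * A $$ (k, l) = A $$ (i, l) * A $$ (k, j)"
    if "i < n" "j < n" "k < n" "l < n" for i j k l
    by (rule vec_space.minor_eq_if_rank_le_1[OF structure_matrix]) (simp_all add: assms(3) that)
  have prod: "op_mult (?R i) (?R j) = op_scale scale (A $$ (j, j)) (?R i)"
    if "i < n" "j < n" for i j
    using minors that by (rule op_mult_right_mult_diagonal)
  have env: "enveloping_set scale emult = op.span (?R ` {..<n})"
    using prod by (rule enveloping_set_eq_span)
  then have basis: "inj_on ?R {..<n}" "op.independent (?R ` {..<n})"
    using op.inj_independent_if_dim_span_eq[of ?R n] assms(2) by simp_all

  have "A \<noteq> 0\<^sub>m n n"
    using assms(3) vec_space.rank_0I[of n n, where 'a='f] by auto
  then obtain i j where ij: "i < n" "j < n" "A $$ (i, j) \<noteq> 0"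
    using structure_matrix by (metis carrier_matD eq_matI index_zero_mat)
  have "?R j \<noteq> 0"
    using basis(2) ij(2) op.dependent_zero[of "?R ` {..<n}"] by force
  then obtain k where "k < n" "A $$ (j, k) \<noteq> 0"
    using right_mult_basis_eq_0[OF ij(2)] by blast
  then have diag: "A $$ (j, j) \<noteq> 0"
    using minors[OF ij(1,2,2), of k] ij(3) \<open>k < n\<close> by (metis mult_eq_0_iff)
  have "algebra_isomorphic (enveloping_algebra scale emult) (M_algebra n n)"
    unfolding enveloping_algebra_def env
  proof (rule op.algebra_isomorphic_M_algebra[OF basis])
    show "op_mult (\<Sum>i<n. op_scale scale (a i) (?R i)) (\<Sum>j<n. op_scale scale (b j) (?R j)) =
        op_scale scale (\<Sum>j<n. b j * A $$ (j, j)) (\<Sum>i<n. op_scale scale (a i) (?R i))" for a b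
      using prod by (rule op_mult_combination)
  qed (use ij(2) diag in simp_all)
  moreover have "n \<in> {1..n}" using ij by simp
  ultimately show ?thesis by blast
qed

end
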